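(* Let $(X,d)$ and $(Y,d')$ be nonempty compact metric spaces and let $T_1:X\to X$ and $T_2:Y\to Y$ be continuous. If $(X,T_1)$ and $(Y,T_2)$ are topologically conjugate with a conjugate map $\pi:X\to Y$, i.e. $\pi$ is a homeomorphism with $\pi\circ T_1=T_2\circ\pi$, then $D_{pre}(s,T_1)=D_{pre}(s,T_2)$ for all $s>0$.
   Context: For a continuous map $T:X\to X$ of a compact metric space $(X,d)$ and $n\in\mathbb{N}=\{1,2,\dots\}$ put $d_{T,n}(x,y)=\max_{0\le j<n}d(T^j(x),T^j(y))$. For $K\subseteq X$ and $\epsilon>0$, a set $E\subseteq K$ is an $(n,\epsilon,K,T)$-separated set if $d_{T,n}(x,y)>\epsilon$ for all $x\ne y$ in $E$; $r(n,\epsilon,K,T)$ denotes the maximal cardinality of an $(n,\epsilon,K,T)$-separated subset of $K$. Here $T^{-k}(x)=\{y\in X: T^k(y)=x\}$. For real $s>0$, the $s$-preimage entropy of $T$ is $$D_{pre}(s,T)=\lim_{\epsilon\to 0}\limsup_{n\to\infty}\frac{1}{n^s}\log\sup_{x\in X,\,k\ge n}r(n,\epsilon,T^{-k}(x),T)\in[0,+\infty].$$ *)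

theory Defs
  imports "HOL-Analysis.Analysis"
begin

text \<open>
  A metric space is given by a carrier set \<open>X\<close> and a metric \<open>d\<close> with \<^locale>\<open>Metric_space\<close>;
  a continuous self-map \<open>T\<close> matters only on \<open>X\<close>.
\<close>

text \<open>Only meaningful for \<open>n \<ge> 1\<close> (for \<open>n = 0\<close> it is the maximum of the empty set).\<close>

definition bowen_dist :: "('a \<Rightarrow> 'a \<Rightarrow> real) \<Rightarrow> ('a \<Rightarrow> 'a) \<Rightarrow> nat \<Rightarrow> 'a \<Rightarrow> 'a \<Rightarrow> real" where
  "bowen_dist d T n x y = Max ((\<lambda>j. d ((T ^^ j) x) ((T ^^ j) y)) ` {0..<n})"

definition separated_set ::
  "('a \<Rightarrow> 'a \<Rightarrow> real) \<Rightarrow> nat \<Rightarrow> real \<Rightarrow> 'a set \<Rightarrow> ('a \<Rightarrow> 'a) \<Rightarrow> 'a set \<Rightarrow> bool" where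
  "separated_set d n \<epsilon> K T E \<longleftrightarrow>
     E \<subseteq> K \<and> (\<forall>x\<in>E. \<forall>y\<in>E. x \<noteq> y \<longrightarrow> bowen_dist d T n x y > \<epsilon>)"

text \<open>
  On a compact space the cardinalities of separated sets (\<open>n \<ge> 1\<close>, \<open>\<epsilon> > 0\<close>) are finite and
  bounded, so the supremum below is a maximum. If there were an infinite separated set, its
  finite subsets would make the value \<open>\<infinity>\<close>; for \<open>K = {}\<close> it is \<open>0\<close>.
\<close>

definition sep_number ::
  "('a \<Rightarrow> 'a \<Rightarrow> real) \<Rightarrow> nat \<Rightarrow> real \<Rightarrow> 'a set \<Rightarrow> ('a \<Rightarrow> 'a) \<Rightarrow> enat" where
  "sep_number d n \<epsilon> K T = (SUP E\<in>{E. finite E \<and> separated_set d n \<epsilon> K T E}. enat (card E))"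

definition preimage :: "'a set \<Rightarrow> ('a \<Rightarrow> 'a) \<Rightarrow> nat \<Rightarrow> 'a \<Rightarrow> 'a set" where
  "preimage X T k x = {y \<in> X. (T ^^ k) y = x}"

text \<open>
  The natural logarithm with its limiting values at \<open>0\<close> and \<open>\<infinity>\<close>. Neither is reached in the
  definition of \<open>D_pre\<close> on a nonempty compact space: \<open>T\<^sup>k(z)\<close> has a nonempty \<open>k\<close>-th preimage
  for any \<open>z \<in> X\<close>, so the supremum there is at least \<open>1\<close>, and it is bounded by the (finite)
  separation number of \<open>X\<close> itself.
\<close>

fun ln_enat :: "enat \<Rightarrow> ereal" where
  "ln_enat (enat m) = (if m = 0 then -\<infinity> else ereal (ln (real m)))"
| "ln_enat \<infinity> = \<infinity>"

definition D_pre_eps ::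
  "'a set \<Rightarrow> ('a \<Rightarrow> 'a \<Rightarrow> real) \<Rightarrow> real \<Rightarrow> ('a \<Rightarrow> 'a) \<Rightarrow> real \<Rightarrow> ereal" where
  "D_pre_eps X d s T \<epsilon> =
     limsup (\<lambda>n. ereal (1 / real n powr s) *
       ln_enat (SUP (x, k)\<in>X \<times> {n..}. sep_number d n \<epsilon> (preimage X T k x) T))"

text \<open>The limit always exists by monotonicity in \<open>\<epsilon>\<close>, see \<open>D_pre_tendsto\<close> below.\<close>

definition D_pre ::
  "'a set \<Rightarrow> ('a \<Rightarrow> 'a \<Rightarrow> real) \<Rightarrow> real \<Rightarrow> ('a \<Rightarrow> 'a) \<Rightarrow> ereal" where
  "D_pre X d s T = Lim (at_right 0) (D_pre_eps X d s T)"

lemma ln_enat_mono: "a \<le> b \<Longrightarrow> ln_enat a \<le> ln_enat b"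
  by (cases a; cases b) auto

lemma sep_number_antimono:
  assumes "\<epsilon> \<le> \<epsilon>'"
  shows "sep_number d n \<epsilon>' K T \<le> sep_number d n \<epsilon> K T"
  unfolding sep_number_def separated_set_def
  by (rule SUP_subset_mono) (use assms in force)+

lemma D_pre_eps_antimono:
  assumes "\<epsilon> \<le> \<epsilon>'"
  shows "D_pre_eps X d s T \<epsilon>' \<le> D_pre_eps X d s T \<epsilon>"
  unfolding D_pre_eps_def
proof (intro Limsup_mono always_eventually allI ereal_mult_left_mono ln_enat_mono)
  fix n
  show "(SUP (x, k)\<in>X \<times> {n..}. sep_number d n \<epsilon>' (preimage X T k x) T)
      \<le> (SUP (x, k)\<in>X \<times> {n..}. sep_number d n \<epsilon> (preimage X T k x) T)"
    by (rule SUP_mono') (auto simp: sep_number_antimono[OF assms])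
qed auto

lemma D_pre_tendsto_SUP:
  "(D_pre_eps X d s T \<longlongrightarrow> (SUP \<epsilon>\<in>{0<..}. D_pre_eps X d s T \<epsilon>)) (at_right 0)"
proof (rule order_tendstoI)
  fix a assume "a < (SUP \<epsilon>\<in>{0<..}. D_pre_eps X d s T \<epsilon>)"
  then obtain e where e: "e > 0" "a < D_pre_eps X d s T e"
    by (auto simp: less_SUP_iff)
  show "\<forall>\<^sub>F \<epsilon> in at_right 0. a < D_pre_eps X d s T \<epsilon>"
    unfolding eventually_at_right_field
    using e D_pre_eps_antimono[of _ e X d s T] by (intro exI[of _ e]) (auto intro: less_le_trans)
next
  fix a assume a: "(SUP \<epsilon>\<in>{0<..}. D_pre_eps X d s T \<epsilon>) < a"
  have "D_pre_eps X d s T \<epsilon> < a" if "\<epsilon> > 0" for \<epsilon>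
    using that by (intro le_less_trans[OF SUP_upper a]) auto
  then show "\<forall>\<^sub>F \<epsilon> in at_right 0. D_pre_eps X d s T \<epsilon> < a"
    unfolding eventually_at_right_field by (intro exI[of _ 1]) auto
qed

lemma D_pre_eq_SUP: "D_pre X d s T = (SUP \<epsilon>\<in>{0<..}. D_pre_eps X d s T \<epsilon>)"
  unfolding D_pre_def by (rule tendsto_Lim[OF _ D_pre_tendsto_SUP]) simp

lemma D_pre_tendsto: "(D_pre_eps X d s T \<longlongrightarrow> D_pre X d s T) (at_right 0)"
  unfolding D_pre_eq_SUP by (rule D_pre_tendsto_SUP)

end

theory Submission
  imports Defs
begin

text \<open>
  A conjugacy \<open>\<pi>\<close> maps the \<open>k\<close>-th preimage of \<open>x\<close> bijectively onto that of \<open>\<pi> x\<close>, and by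
  compactness it is uniformly continuous. If \<open>d x y \<le> \<delta>\<close> forces \<open>d' (\<pi> x) (\<pi> y) \<le> \<epsilon>\<close>, then
  the inverse of \<open>\<pi>\<close> carries \<open>(n, \<epsilon>)\<close>-separated sets of \<open>T2\<close> to \<open>(n, \<delta>)\<close>-separated sets of
  \<open>T1\<close>, for all \<open>n\<close> at once. This gives one inequality between the entropies, and the inverse
  conjugacy gives the other.
\<close>

lemma funpow_in_carrier: "f \<in> X \<rightarrow> X \<Longrightarrow> x \<in> X \<Longrightarrow> (f ^^ n) x \<in> X"
  by (induction n) auto

lemma funpow_semiconjugate:
  assumes "T1 \<in> X \<rightarrow> X" "\<And>x. x \<in> X \<Longrightarrow> h (T1 x) = T2 (h x)" "x \<in> X"
  shows "h ((T1 ^^ n) x) = (T2 ^^ n) (h x)"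
  by (induction n) (use assms funpow_in_carrier[of T1 X x] in auto)

lemma bowen_dist_le_iff:
  "n > 0 \<Longrightarrow> bowen_dist d T n x y \<le> r \<longleftrightarrow> (\<forall>j<n. d ((T ^^ j) x) ((T ^^ j) y) \<le> r)"
  unfolding bowen_dist_def by (subst Max_le_iff) auto

text \<open>Separated sets are pulled back from \<open>Y\<close> rather than pushed forward, so only
  a modulus of continuity of \<open>h\<close> itself is needed. The modulus uses \<le> on both sides
  because the failure of the strict separation inequality is what gets transported.\<close>

lemma sep_number_preimage_le:
  assumes T1: "T1 \<in> X \<rightarrow> X" and bij: "bij_betw h X Y"
    and conj: "\<And>x. x \<in> X \<Longrightarrow> h (T1 x) = T2 (h x)"
    and unif: "\<And>x y. x \<in> X \<Longrightarrow> y \<in> X \<Longrightarrow> d x y \<le> \<delta> \<Longrightarrow> d' (h x) (h y) \<le> \<epsilon>"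
    and "n > 0" "x \<in> X"
  shows "sep_number d' n \<epsilon> (preimage Y T2 k (h x)) T2
    \<le> sep_number d n \<delta> (preimage X T1 k x) T1"
  unfolding sep_number_def
proof (rule SUP_mono)
  fix E assume E: "E \<in> {E. finite E \<and> separated_set d' n \<epsilon> (preimage Y T2 k (h x)) T2 E}"
  define g where "g = inv_into X h"
  have EY: "E \<subseteq> Y" "\<And>y. y \<in> E \<Longrightarrow> (T2 ^^ k) y = h x"
    using E by (auto simp: separated_set_def preimage_def)
  have g: "g y \<in> X" "h (g y) = y" if "y \<in> E" for y
    using that EY bij unfolding g_def bij_betw_def
    by (auto simp: f_inv_into_f inv_into_into)
  have inj: "inj_on g E"
    by (metis g(2) inj_onI)
  note pow = funpow_in_carrier[OF T1] funpow_semiconjugate[where h = h, OF T1 conj]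
  \<comment> \<open>Both sides have the image \<open>h x\<close>, since
    \<open>h ((T1 ^^ k) (g y)) = (T2 ^^ k) y\<close>; injectivity of \<open>h\<close> on
    \<open>X\<close> then applies.\<close>
  have "(T1 ^^ k) (g y) = x" if "y \<in> E" for y
    using that g EY pow \<open>x \<in> X\<close> bij by (metis bij_betw_def inj_on_def)
  then have sub: "g ` E \<subseteq> preimage X T1 k x"
    using g by (auto simp: preimage_def)
  have "bowen_dist d T1 n (g y) (g z) > \<delta>" if yz: "y \<in> E" "z \<in> E" "y \<noteq> z" for y z
  proof (rule ccontr)
    assume "\<not> bowen_dist d T1 n (g y) (g z) > \<delta>"
    \<comment> \<open>The modulus is applied at each time \<open>j < n\<close> separately, so
      \<delta> does not depend on \<open>n\<close>.\<close>
    then have "d' (h ((T1 ^^ j) (g y))) (h ((T1 ^^ j) (g z))) \<le> \<epsilon>" if "j < n" for j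
      using that yz g pow(1) \<open>n > 0\<close> by (intro unif) (auto simp: not_less bowen_dist_le_iff)
    then have "bowen_dist d' T2 n y z \<le> \<epsilon>"
      using yz g pow(2) \<open>n > 0\<close> by (simp add: bowen_dist_le_iff)
    then show False
      using E yz by (force simp: separated_set_def)
  qed
  then have "separated_set d n \<delta> (preimage X T1 k x) T1 (g ` E)"
    using sub by (auto simp: separated_set_def)
  then show "\<exists>F\<in>{F. finite F \<and> separated_set d n \<delta> (preimage X T1 k x) T1 F}.
      enat (card E) \<le> enat (card F)"
    using E inj by (intro bexI[of _ "g ` E"]) (auto simp: card_image)
qed

lemma D_pre_eps_le:
  assumes "T1 \<in> X \<rightarrow> X" and bij: "bij_betw h X Y"
    and "\<And>x. x \<in> X \<Longrightarrow> h (T1 x) = T2 (h x)"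
    and "\<And>x y. x \<in> X \<Longrightarrow> y \<in> X \<Longrightarrow> d x y \<le> \<delta> \<Longrightarrow> d' (h x) (h y) \<le> \<epsilon>"
  shows "D_pre_eps Y d' s T2 \<epsilon> \<le> D_pre_eps X d s T1 \<delta>"
  unfolding D_pre_eps_def
\<comment> \<open>The case \<open>n = 0\<close>, where \<open>bowen_dist\<close> is a
  \<open>Max\<close> over the empty set, is invisible to the limsup.\<close>
proof (rule Limsup_mono, rule eventually_mono[OF eventually_gt_at_top[of 0]])
  fix n :: nat assume "n > 0"
  have "(SUP (y, k)\<in>Y \<times> {n..}. sep_number d' n \<epsilon> (preimage Y T2 k y) T2)
      \<le> (SUP (x, k)\<in>X \<times> {n..}. sep_number d n \<delta> (preimage X T1 k x) T1)"
  proof (rule SUP_mono)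
    fix p assume "p \<in> Y \<times> {n..}"
    then obtain x k where "p = (h x, k)" "x \<in> X" "k \<ge> n"
      using bij by (auto simp: bij_betw_def)
    then show "\<exists>q\<in>X \<times> {n..}. (case p of (y, k) \<Rightarrow> sep_number d' n \<epsilon> (preimage Y T2 k y) T2)
        \<le> (case q of (x, k) \<Rightarrow> sep_number d n \<delta> (preimage X T1 k x) T1)"
      using \<open>n > 0\<close> assms
      by (intro bexI[of _ "(x, k)"]) (auto intro!: sep_number_preimage_le[where h = h])
  qed
  then show "ereal (1 / real n powr s) *
        ln_enat (SUP (y, k)\<in>Y \<times> {n..}. sep_number d' n \<epsilon> (preimage Y T2 k y) T2)
      \<le> ereal (1 / real n powr s) *
        ln_enat (SUP (x, k)\<in>X \<times> {n..}. sep_number d n \<delta> (preimage X T1 k x) T1)"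
    by (intro ereal_mult_left_mono ln_enat_mono) auto
qed

lemma D_pre_le:
  assumes "Metric_space X d" "Metric_space Y d'"
    and "compact_space (Metric_space.mtopology X d)"
    and "continuous_map (Metric_space.mtopology X d) (Metric_space.mtopology Y d') h"
    and T1: "T1 \<in> X \<rightarrow> X" and bij: "bij_betw h X Y"
    and conj: "\<And>x. x \<in> X \<Longrightarrow> h (T1 x) = T2 (h x)"
  shows "D_pre Y d' s T2 \<le> D_pre X d s T1"
proof -
  interpret X: Metric_space X d by fact
  interpret Y: Metric_space Y d' by fact
  \<comment> \<open>Heine-Cantor, by compactness of \<open>X\<close>.\<close>
  have unif: "uniformly_continuous_map (metric (X, d)) (metric (Y, d')) h"
    using assms by (intro continuous_eq_uniformly_continuous_map[THEN iffD1]) auto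
  show ?thesis
    unfolding D_pre_eq_SUP
  \<comment> \<open>With the limits written as suprema, it suffices to bound the term of each
    \<epsilon> by that of some \<delta>.\<close>
  proof (rule SUP_mono)
    fix \<epsilon> :: real assume "\<epsilon> \<in> {0<..}"
    then obtain \<delta> where \<delta>: "\<delta> > 0"
      "\<And>x y. x \<in> X \<Longrightarrow> y \<in> X \<Longrightarrow> d y x < \<delta> \<Longrightarrow> d' (h y) (h x) < \<epsilon>"
      using unif unfolding uniformly_continuous_map_def by auto
    \<comment> \<open>Halving turns the strict bound \<open>< \<delta>\<close> of uniform continuity
      into the non-strict one that \<open>D_pre_eps_le\<close> asks for.\<close>
    then have "D_pre_eps Y d' s T2 \<epsilon> \<le> D_pre_eps X d s T1 (\<delta> / 2)"
      by (intro D_pre_eps_le[OF T1 bij conj] less_imp_le[of "d' _ _"])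
        (auto simp: X.commute Y.commute)
    then show "\<exists>\<delta>\<in>{0<..}. D_pre_eps Y d' s T2 \<epsilon> \<le> D_pre_eps X d s T1 \<delta>"
      using \<delta>(1) by (intro bexI[of _ "\<delta> / 2"]) auto
  qed
qed

theorem theorem3p3:
  fixes X :: "'a set" and d :: "'a \<Rightarrow> 'a \<Rightarrow> real" and T1 :: "'a \<Rightarrow> 'a"
    and Y :: "'b set" and d' :: "'b \<Rightarrow> 'b \<Rightarrow> real" and T2 :: "'b \<Rightarrow> 'b"
    and \<pi> :: "'a \<Rightarrow> 'b"
  assumes "Metric_space X d" and "Metric_space Y d'"
    and "X \<noteq> {}" and "Y \<noteq> {}"
    and "compact_space (Metric_space.mtopology X d)"
    and "compact_space (Metric_space.mtopology Y d')"
    and "continuous_map (Metric_space.mtopology X d) (Metric_space.mtopology X d) T1"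
    and "continuous_map (Metric_space.mtopology Y d') (Metric_space.mtopology Y d') T2"
    and "homeomorphic_map (Metric_space.mtopology X d) (Metric_space.mtopology Y d') \<pi>"
    and "\<forall>x\<in>X. \<pi> (T1 x) = T2 (\<pi> x)"
  shows "\<forall>s::real. s > 0 \<longrightarrow> D_pre X d s T1 = D_pre Y d' s T2"
proof (intro allI impI antisym)
  fix s :: real
  interpret X: Metric_space X d by fact
  interpret Y: Metric_space Y d' by fact
  obtain \<rho> where "homeomorphic_maps X.mtopology Y.mtopology \<pi> \<rho>"
    using assms(9) homeomorphic_map_maps by blast
  then have \<pi>: "continuous_map X.mtopology Y.mtopology \<pi>" "\<And>x. x \<in> X \<Longrightarrow> \<rho> (\<pi> x) = x"
    and \<rho>: "continuous_map Y.mtopology X.mtopology \<rho>" "\<And>y. y \<in> Y \<Longrightarrow> \<pi> (\<rho> y) = y"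
    by (auto simp: homeomorphic_maps_def)
  have maps: "\<pi> \<in> X \<rightarrow> Y" "\<rho> \<in> Y \<rightarrow> X" "T1 \<in> X \<rightarrow> X" "T2 \<in> Y \<rightarrow> Y"
    using assms(7,8)[THEN continuous_map_funspace] \<pi>(1)[THEN continuous_map_funspace]
      \<rho>(1)[THEN continuous_map_funspace] by auto
  have bij: "bij_betw \<pi> X Y" "bij_betw \<rho> Y X"
    using maps \<pi>(2) \<rho>(2) by (auto intro!: bij_betwI)
  \<comment> \<open>Apply \<rho> to
    \<open>\<pi> (T1 (\<rho> y)) = T2 (\<pi> (\<rho> y)) = T2 y\<close>; here
    \<open>T1 (\<rho> y)\<close> lies in \<open>X\<close>, where \<rho> undoes \<pi>.\<close>
  have "\<rho> (T2 y) = T1 (\<rho> y)" if "y \<in> Y" for y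
    using that assms(10) maps \<pi>(2) \<rho>(2) by (metis Pi_iff)
  \<comment> \<open>This direction uses \<rho> as the conjugacy, with compactness of
    \<open>Y\<close>; the other uses \<pi> and compactness of \<open>X\<close>.\<close>
  then show "D_pre X d s T1 \<le> D_pre Y d' s T2"
    using assms \<rho> maps bij by (intro D_pre_le)
  show "D_pre Y d' s T2 \<le> D_pre X d s T1"
    using assms \<pi> maps bij by (intro D_pre_le) auto
qed

end
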